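(* Let $f:\mathbb{R}^n\to\mathbb{R}$ be a polynomial that is affine in each block $x^{(j)}$, $j\in[m]$ (the other blocks being fixed), and let $\Phi^{(j)}$ denote its partial gradient with respect to the block $x^{(j)}$. Let $\hat y\in\mathbb{R}^n$ be a vector satisfying $$\hat y^{(j)}=\hat\sigma\left(-\Phi^{(j)}(\hat y)\right)\qquad\text{for all } j\in[m].$$ Then $\hat y$ (which belongs to $\bar{\mathcal X}$) is a local optimum of $f$ in $\bar{\mathcal X}$.
   Context: Write $[k]=\{1,\dots,k\}$. The index set $[n]$ is partitioned into $m$ disjoint subsets $I_1,\dots,I_m$ with $d_j:=|I_j|\ge 2$. A vector $x\in\mathbb{R}^n$ is correspondingly divided into blocks $x=(x^{(1)},\dots,x^{(m)})$ with $x^{(j)}\in\mathbb{R}^{d_j}$, whose entries are $x^{(j)}_i$, $i\in[d_j]$. Let $x^{(\bar j)}$ denote the $(n-d_j)$-dimensional vector obtained from $x$ by deleting the block $x^{(j)}$, and $(x^{(\bar j)},\xi)$ the vector obtained from $x$ by replacing $x^{(j)}$ with $\xi\in\mathbb{R}^{d_j}$. The multiple choice polynomial programming (MCPP) problem is: minimize $f(x)$ over $x\in\{0,1\}^n$ subject to $\sum_{i=1}^{d_j}x^{(j)}_i=1$ for all $j\in[m]$. Define $\Phi^{(j)}_i=\partial f/\partial x^{(j)}_i$ and $\Phi^{(j)}=(\Phi^{(j)}_i)_{i\in[d_j]}$. Since $f$ is affine in each block, $\Phi^{(j)}$ does not depend on $x^{(j)}$, and $f(x)=x^{(j)}\cdot\Phi^{(j)}(x)+f((x^{(\bar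 j)},0))$ for every $j$. For $z\in\mathbb{R}^d$, $\hat\sigma(z)=(\hat\sigma_i(z))_{i\in[d]}$ is defined by $\hat\sigma_i(z)=1/r$ if $z_i=\max\{z_1,\dots,z_d\}$ and $\hat\sigma_i(z)=0$ otherwise, where $r$ is the number of indices $i$ with $z_i=\max\{z_1,\dots,z_d\}$. For $d\ge1$ let $\bar B_d=\{\frac{1}{|A|}\chi^A : \varnothing\ne A\subseteq[d]\}\subset\mathbb{R}^d$, where $\chi^A\in\mathbb{R}^d$ is the indicator vector of $A$ ($\chi^A_i=1$ if $i\in A$ and $0$ otherwise), and let $\bar{\mathcal X}=\bar B_{d_1}\times\cdots\times\bar B_{d_m}$. Local optimality: $x\in\bar{\mathcal X}$ is a local optimum of $f$ in $\bar{\mathcal X}$ if $f(x')\ge f(x)$ for every $x'\in\bar{\mathcal X}$ for which there exists $j_0\in[m]$ with $(x')^{(\bar{j_0})}=x^{(\bar{j_0})}$. *)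

theory Defs
  imports "HOL-Analysis.Analysis"
begin

text \<open>
  A vector of \<open>real ^ 'n\<close> has one block for each set of coordinates \<open>D :: 'n set\<close>. The space
  $\mathbb{R}^D$ is represented by the functions \<open>'n \<Rightarrow> real\<close> that are extensional on \<open>D\<close>
  (\<open>undefined\<close> outside \<open>D\<close>), so that equality of blocks is plain equality. The entries of a block
  keep their labels in \<open>D\<close> instead of being renumbered as $1,\dots,|D|$.
\<close>

definition block :: "'n set \<Rightarrow> real ^ 'n \<Rightarrow> 'n \<Rightarrow> real" where
  "block D x = (\<lambda>i\<in>D. x $ i)"

text \<open>The vectors \<open>y\<close> below are exactly the \<open>x\<close> with its block \<open>D\<close> replaced arbitrarily.\<close>

definition affine_in_block :: "'n::finite set \<Rightarrow> (real ^ 'n \<Rightarrow> real) \<Rightarrow> bool" where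
  "affine_in_block D f \<longleftrightarrow>
     (\<forall>x. \<exists>a c. \<forall>y. block (- D) y = block (- D) x \<longrightarrow> f y = (\<Sum>i\<in>D. a i * block D y i) + c)"

definition block_gradient :: "'n::finite set \<Rightarrow> (real ^ 'n \<Rightarrow> real) \<Rightarrow> real ^ 'n \<Rightarrow> 'n \<Rightarrow> real" where
  "block_gradient D f x = (\<lambda>i\<in>D. deriv (\<lambda>t. f (x + t *\<^sub>R axis i 1)) 0)"

definition sigma_hat :: "'n set \<Rightarrow> ('n \<Rightarrow> real) \<Rightarrow> 'n \<Rightarrow> real" where
  "sigma_hat D z =
     (\<lambda>i\<in>D. if z i = Max (z ` D) then 1 / real (card {k \<in> D. z k = Max (z ` D)}) else 0)"

definition Bbar :: "'n set \<Rightarrow> ('n \<Rightarrow> real) set" where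
  "Bbar D = {(\<lambda>i\<in>D. 1 / real (card A) * indicator A i) | A. A \<noteq> {} \<and> A \<subseteq> D}"

definition Xbar :: "nat \<Rightarrow> (nat \<Rightarrow> 'n set) \<Rightarrow> (real ^ 'n) set" where
  "Xbar m I = {x. \<forall>j\<in>{1..m}. block (I j) x \<in> Bbar (I j)}"

definition local_optimum :: "nat \<Rightarrow> (nat \<Rightarrow> 'n set) \<Rightarrow> (real ^ 'n \<Rightarrow> real) \<Rightarrow> real ^ 'n \<Rightarrow> bool" where
  "local_optimum m I f x \<longleftrightarrow>
     x \<in> Xbar m I \<and>
     (\<forall>x'\<in>Xbar m I. (\<exists>j\<^sub>0\<in>{1..m}. block (- I j\<^sub>0) x' = block (- I j\<^sub>0) x) \<longrightarrow> f x' \<ge> f x)"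

end

theory Submission
  imports Defs
begin

text \<open>
  With the other blocks held fixed, \<open>f\<close> is an affine function of the block \<open>D = I j\<close> whose linear
  part is the partial gradient \<open>\<Phi>\<close>. Hence changing only this block of \<open>yhat\<close> changes \<open>f\<close> exactly as
  it changes \<open>\<xi> \<mapsto> \<Sum>i\<in>D. \<Phi> i * \<xi> i\<close>. On \<open>Bbar D\<close> this sum is the mean of \<open>\<Phi>\<close> over a nonempty
  subset of \<open>D\<close>, so it is at least the minimum of \<open>\<Phi>\<close> (\<open>sum_Bbar_le_Max\<close>, applied to
  \<open>z = - \<Phi>\<close>), and \<open>sigma_hat D (- \<Phi>)\<close>, the mean over the minimisers, attains that minimum
  (\<open>sum_sigma_hat_eq_Max\<close>). The fixed-point equation places this very minimiser in the block of
  \<open>yhat\<close>. That \<open>\<Phi>\<close> does not depend on the block \<open>D\<close> is what makes the comparison global in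
  this block, although \<open>\<Phi>\<close> is evaluated at \<open>yhat\<close>.
\<close>

lemma sum_normalized_indicator:
  fixes z :: "'n \<Rightarrow> real"
  assumes "finite D" "A \<subseteq> D"
  shows "(\<Sum>i\<in>D. z i * (1 / real (card A) * indicator A i)) = (\<Sum>i\<in>A. z i) / real (card A)"
proof -
  have "(\<Sum>i\<in>D. z i * (1 / real (card A) * indicator A i))
      = (\<Sum>i\<in>A. z i * (1 / real (card A) * indicator A i))"
    by (rule sum.mono_neutral_right) (use assms in auto)
  also have "\<dots> = (\<Sum>i\<in>A. z i / real (card A))"
    by (rule sum.cong) auto
  finally show ?thesis
    by (simp add: sum_divide_distrib)
qed

lemma sum_Bbar_le_Max:
  fixes z :: "'n \<Rightarrow> real"
  assumes "finite D" "b \<in> Bbar D"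
  shows "(\<Sum>i\<in>D. z i * b i) \<le> Max (z ` D)"
proof -
  obtain A where A: "A \<noteq> {}" "A \<subseteq> D"
    and b: "b = (\<lambda>i\<in>D. 1 / real (card A) * indicator A i)"
    using assms(2) unfolding Bbar_def by blast
  have pos: "card A > 0"
    using A assms(1) finite_subset card_gt_0_iff by blast
  have "(\<Sum>i\<in>D. z i * b i) = (\<Sum>i\<in>A. z i) / real (card A)"
    using sum_normalized_indicator[OF assms(1) A(2), of z] by (simp add: b)
  moreover have "(\<Sum>i\<in>A. z i) \<le> real (card A) * Max (z ` D)"
    by (rule sum_bounded_above) (use A assms(1) in auto)
  ultimately show ?thesis
    using pos by (simp add: divide_le_eq mult.commute)
qed

text \<open>This shape shows that \<open>sigma_hat D z\<close> is the point of \<open>Bbar D\<close> belonging to the set of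
  maximisers of \<open>z\<close>, so that \<open>sum_normalized_indicator\<close> applies to it.\<close>

lemma sigma_hat_eq_normalized_indicator:
  "sigma_hat D z = (\<lambda>i\<in>D. 1 / real (card {k \<in> D. z k = Max (z ` D)})
      * indicator {k \<in> D. z k = Max (z ` D)} i)"
  unfolding sigma_hat_def by (rule restrict_ext) auto

lemma maximisers_nonempty:
  fixes z :: "'n \<Rightarrow> real"
  assumes "finite D" "D \<noteq> {}"
  shows "{k \<in> D. z k = Max (z ` D)} \<noteq> {}"
  using Max_in[of "z ` D"] assms by fastforce

lemma sigma_hat_in_Bbar:
  assumes "finite D" "D \<noteq> {}"
  shows "sigma_hat D z \<in> Bbar D"
  unfolding sigma_hat_eq_normalized_indicator Bbar_def
  using maximisers_nonempty[OF assms, of z] by blast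

lemma sum_sigma_hat_eq_Max:
  assumes "finite D" "D \<noteq> {}"
  shows "(\<Sum>i\<in>D. z i * sigma_hat D z i) = Max (z ` D)"
proof -
  let ?A = "{k \<in> D. z k = Max (z ` D)}"
  have "card ?A > 0"
    using maximisers_nonempty[OF assms, of z] assms(1) by (simp add: card_gt_0_iff)
  moreover have "(\<Sum>i\<in>D. z i * sigma_hat D z i) = (\<Sum>i\<in>?A. z i) / real (card ?A)"
    using sum_normalized_indicator[OF assms(1), of ?A z]
    by (simp add: sigma_hat_eq_normalized_indicator)
  moreover have "(\<Sum>i\<in>?A. z i) = real (card ?A) * Max (z ` D)"
    by simp
  ultimately show ?thesis
    by (simp add: field_simps)
qed

text \<open>Along the \<open>i\<close>-th coordinate line with \<open>i \<in> D\<close> only the block \<open>D\<close> changes, so \<open>f\<close> is affine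
  there with slope equal to the \<open>i\<close>-th coefficient; this identifies the coefficients of \<open>f\<close> in the
  block with its partial gradient.\<close>

lemma affine_in_block_expansion:
  fixes f :: "real ^ 'n \<Rightarrow> real"
  assumes "affine_in_block D f"
  obtains c where "\<And>y. block (- D) y = block (- D) x \<Longrightarrow>
    f y = (\<Sum>i\<in>D. block_gradient D f x i * block D y i) + c"
proof -
  obtain a c where f: "\<And>y. block (- D) y = block (- D) x \<Longrightarrow>
      f y = (\<Sum>i\<in>D. a i * block D y i) + c"
    using assms unfolding affine_in_block_def by metis
  have slope: "block_gradient D f x i = a i" if i: "i \<in> D" for i
  proof -
    have line: "f (x + t *\<^sub>R axis i 1) = f x + a i * t" for t
    proof -
      have "block (- D) (x + t *\<^sub>R axis i 1) = block (- D) x"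
        unfolding block_def using i by (intro restrict_ext) (auto simp: axis_def)
      then have "f (x + t *\<^sub>R axis i 1) = (\<Sum>k\<in>D. a k * (x + t *\<^sub>R axis i 1) $ k) + c"
        by (simp add: f block_def)
      also have "(\<Sum>k\<in>D. a k * (x + t *\<^sub>R axis i 1) $ k)
          = (\<Sum>k\<in>D. a k * x $ k) + (\<Sum>k\<in>D. if k = i then a k * t else 0)"
        unfolding sum.distrib[symmetric]
        by (rule sum.cong) (auto simp: axis_def algebra_simps)
      also have "(\<Sum>k\<in>D. if k = i then a k * t else 0) = a i * t"
        using i by simp
      finally show ?thesis
        by (simp add: f block_def)
    qed
    have "((\<lambda>t. f x + a i * t) has_field_derivative a i) (at 0)"
      by (auto intro!: derivative_eq_intros)
    then show ?thesis
      using i by (simp add: block_gradient_def line DERIV_imp_deriv)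
  qed
  show thesis
    by (rule that[of c]) (simp add: f slope)
qed

theorem proposition3p2:
  fixes f :: "real ^ 'n \<Rightarrow> real"
    and m :: nat
    and I :: "nat \<Rightarrow> 'n set"
    and yhat :: "real ^ 'n"
  assumes "disjoint_family_on I {1..m}"
    and "(\<Union>j\<in>{1..m}. I j) = UNIV"
    and "\<forall>j\<in>{1..m}. card (I j) \<ge> 2"
    and "real_polynomial_function f"
    and "\<forall>j\<in>{1..m}. affine_in_block (I j) f"
    and "\<forall>j\<in>{1..m}. block (I j) yhat = sigma_hat (I j) (\<lambda>i. - block_gradient (I j) f yhat i)"
  shows "local_optimum m I f yhat"
proof -
  have nonempty: "I j \<noteq> {}" if "j \<in> {1..m}" for j
    using assms(3) that by fastforce
  have "yhat \<in> Xbar m I"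
    unfolding Xbar_def using assms(6) nonempty by (auto intro!: sigma_hat_in_Bbar)
  moreover have "f yhat \<le> f x'"
    if x': "x' \<in> Xbar m I" and j: "j \<in> {1..m}" and same: "block (- I j) x' = block (- I j) yhat"
    for x' j
  proof -
    define z where "z i = - block_gradient (I j) f yhat i" for i
    obtain c where "\<And>y. block (- I j) y = block (- I j) yhat \<Longrightarrow>
        f y = (\<Sum>i\<in>I j. block_gradient (I j) f yhat i * block (I j) y i) + c"
      using affine_in_block_expansion[of "I j" f yhat] assms(5) j by blast
    then have f: "f y = c - (\<Sum>i\<in>I j. z i * block (I j) y i)"
      if "block (- I j) y = block (- I j) yhat" for y
      using that by (simp add: z_def sum_negf)
    have "(\<Sum>i\<in>I j. z i * block (I j) x' i) \<le> Max (z ` I j)"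
      using x' j by (intro sum_Bbar_le_Max) (auto simp: Xbar_def)
    also have "\<dots> = (\<Sum>i\<in>I j. z i * sigma_hat (I j) z i)"
      by (rule sum_sigma_hat_eq_Max[symmetric]) (use nonempty[OF j] in auto)
    also have "sigma_hat (I j) z = block (I j) yhat"
      using assms(6) j by (simp add: z_def[abs_def])
    finally show ?thesis
      by (simp add: f same)
  qed
  ultimately show ?thesis
    unfolding local_optimum_def by blast
qed

end
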